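(* Let $n\ge 0$ be an integer and let $\varepsilon_R\in\{-1,+1\}$ be given for each $R\in\mathcal D^2$ with $|R|=2^{-n}$. Then the set of points $x\in[0,1)^2$ at which the sum $\sum_{R\in\mathcal D^2:\,|R|=2^{-n}}\varepsilon_R h_R(x)$ achieves its maximal value of $n+1$ consists of (i.e. is the union of) $2^{n+1}$ dyadic squares of side length $2^{-(n+1)}$, whose lower left corners form a $(0,n+1,2)$-net in base $2$; that is, every dyadic box of area $2^{-(n+1)}$ contains precisely one square from this collection.
   Context: $\mathcal D$ denotes the set of dyadic intervals in $[0,1)$, i.e. intervals $[m2^{-k},(m+1)2^{-k})$ with $k\in\mathbb N_0=\{0,1,2,\dots\}$ and $m\in\{0,1,\dots,2^k-1\}$. For $I\in\mathcal D$, the ($L^\infty$-normalized) Haar function is $h_I=-\mathbf 1_{I_{left}}+\mathbf 1_{I_{right}}$, where $I_{left},I_{right}$ are the left and right (half-open) halves of $I$; so $h_I=0$ outside $I$. $\mathcal D^2$ is the set of dyadic rectangles (boxes) $R=R_1\times R_2$ with $R_1,R_2\in\mathcal D$, $|R|=|R_1|\,|R_2|$ is the area, and $h_R(x_1,x_2)=h_{R_1}(x_1)h_{R_2}(x_2)$. A dyadic square is a dyadic box with $|R_1|=|R_2|$. For integers $t\ge0$, $m\ge 0$, a set $\mathcal P\subset[0,1)^2$ of $2^m$ points is a $(t,m,2)$-net in base $2$ (a dyadic or binary net) if every dyadic box of area $2^{t-m}$ contains precisely $2^t$ points of $\mathcal P$. In particular, a $(0,m,2)$-net in base 2 is a set of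 $2^m$ points such that every dyadic box of area $2^{-m}$ contains exactly one of them. *)

theory Defs
  imports "HOL-Analysis.Analysis"
begin

definition unit_square :: "(real \<times> real) set" where
  "unit_square = {0..<1} \<times> {0..<1}"

definition dyadic_interval :: "nat \<Rightarrow> nat \<Rightarrow> real set" where
  "dyadic_interval k m = {real m / 2 ^ k ..< (real m + 1) / 2 ^ k}"

definition dyadic_intervals :: "real set set" where
  "dyadic_intervals = {dyadic_interval k m | k m. m < 2 ^ k}"

definition dyadic_boxes :: "(real \<times> real) set set" where
  "dyadic_boxes = {A \<times> B | A B. A \<in> dyadic_intervals \<and> B \<in> dyadic_intervals}"

definition dyadic_squares :: "(real \<times> real) set set" where
  "dyadic_squares = {A \<times> B | A B. A \<in> dyadic_intervals \<and> B \<in> dyadic_intervals \<and>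
     measure lborel A = measure lborel B}"

definition dyadic_boxes_of_area :: "real \<Rightarrow> (real \<times> real) set set" where
  "dyadic_boxes_of_area a = {R \<in> dyadic_boxes. measure lborel R = a}"

definition dyadic_squares_of_side :: "real \<Rightarrow> (real \<times> real) set set" where
  "dyadic_squares_of_side s = {S \<in> dyadic_squares. measure lborel (fst ` S) = s}"

(* The next functions are meant for nonempty half-open intervals I = [a, b),
   where Inf I = a and Sup I = b. *)

definition left_half :: "real set \<Rightarrow> real set" where
  "left_half I = {Inf I ..< (Inf I + Sup I) / 2}"

definition right_half :: "real set \<Rightarrow> real set" where
  "right_half I = {(Inf I + Sup I) / 2 ..< Sup I}"

definition haar :: "real set \<Rightarrow> real \<Rightarrow> real" where
  "haar I x = - indicat_real (left_half I) x + indicat_real (right_half I) x"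

(* For a nonempty box R the images under fst and snd are its two factors. *)

definition haar_box :: "(real \<times> real) set \<Rightarrow> real \<times> real \<Rightarrow> real" where
  "haar_box R x = haar (fst ` R) (fst x) * haar (snd ` R) (snd x)"

definition lower_left_corner :: "(real \<times> real) set \<Rightarrow> real \<times> real" where
  "lower_left_corner R = (Inf (fst ` R), Inf (snd ` R))"

definition binary_net :: "nat \<Rightarrow> nat \<Rightarrow> (real \<times> real) set \<Rightarrow> bool" where
  "binary_net t m P \<longleftrightarrow> P \<subseteq> unit_square \<and> finite P \<and> card P = 2 ^ m \<and>
     (\<forall>R \<in> dyadic_boxes_of_area (2 powi (int t - int m)). card (P \<inter> R) = 2 ^ t)"

definition signed_haar_sum ::
  "nat \<Rightarrow> ((real \<times> real) set \<Rightarrow> real) \<Rightarrow> real \<times> real \<Rightarrow> real" where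
  "signed_haar_sum n \<epsilon> x = (\<Sum>R \<in> dyadic_boxes_of_area (1 / 2 ^ n). \<epsilon> R * haar_box R x)"

end

theory Submission imports Defs begin

text \<open>
  A point of the unit square lies in exactly one box of shape \<open>2\<^sup>-\<^sup>k \<times> 2\<^sup>-\<^sup>(\<^sup>n\<^sup>-\<^sup>k\<^sup>)\<close> for each
  \<open>k \<le> n\<close>, so the sum has \<open>n + 1\<close> nonvanishing terms \<open>\<plusminus>1\<close> and is maximal iff all of them are \<open>1\<close>.
  Let \<open>a, b\<close> be the integers formed by the first \<open>n + 1\<close> binary digits of the coordinates,
  digit \<open>i\<close> being the one of weight \<open>2\<^sup>i\<close>.
  The \<open>k\<close>-th term is \<open>1\<close> iff the sum modulo 2 of digit \<open>n - k\<close> of \<open>a\<close> and digit \<open>k\<close> of \<open>b\<close> has a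
  value prescribed by the digits of \<open>a\<close> above \<open>n - k\<close> and those of \<open>b\<close> above \<open>k\<close>. A dyadic box of
  area \<open>2\<^sup>-\<^sup>(\<^sup>n\<^sup>+\<^sup>1\<^sup>)\<close> fixes the top \<open>j\<close> digits of \<open>a\<close> and the top \<open>n + 1 - j\<close> digits of \<open>b\<close>; the
  \<open>n + 1\<close> conditions then determine the remaining digits, from the highest to the lowest, first
  those of \<open>a\<close> and then those of \<open>b\<close>.
\<close>

section \<open>Binary digits prescribed from the top down\<close>

text \<open>Each rule gives digit \<open>i\<close> in terms of the digits above it, so the free
  digits are forced one after another, starting just below the prefix \<open>p\<close>.\<close>

lemma ex1_nat_with_digits:
  fixes f :: "nat \<Rightarrow> nat \<Rightarrow> bool"
  shows "\<exists>!a::nat. a div 2 ^ m = p \<and> (\<forall>i<m. odd (a div 2 ^ i) \<longleftrightarrow> f i (a div 2 ^ Suc i))"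
proof (induction m arbitrary: p)
  case 0
  show ?case by simp
next
  case (Suc m)
  \<comment> \<open>The prefix \<open>p\<close> is extended by the digit that \<open>f\<close>
    prescribes at position \<open>m\<close>; this leaves \<open>m\<close> free digits, and the
    induction hypothesis applies to the new prefix.\<close>
  define p' where "p' = 2 * p + of_bool (f m p)"
  have "a div 2 ^ m = p' \<longleftrightarrow> a div 2 ^ Suc m = p \<and> (odd (a div 2 ^ m) \<longleftrightarrow> f m (a div 2 ^ Suc m))"
    for a :: nat
  proof -
    have *: "a div 2 ^ Suc m = a div 2 ^ m div 2"
      by (simp only: power_Suc2 div_mult2_eq)
    have digit: "c = 2 * p + of_bool B \<longleftrightarrow> c div 2 = p \<and> (odd c \<longleftrightarrow> B)" for c :: nat and B
      by (cases B) (simp_all, presburger+)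
    show ?thesis
      unfolding * p'_def digit by (simp only: cong: conj_cong)
  qed
  then have "(\<lambda>a. a div 2 ^ Suc m = p \<and> (\<forall>i<Suc m. odd (a div 2 ^ i) \<longleftrightarrow> f i (a div 2 ^ Suc i)))
      = (\<lambda>a. a div 2 ^ m = p' \<and> (\<forall>i<m. odd (a div 2 ^ i) \<longleftrightarrow> f i (a div 2 ^ Suc i)))"
    by (auto simp only: less_Suc_eq fun_eq_iff)
  with Suc.IH[of p'] show ?case by simp
qed

lemma nat_div_power_of_prefix:
  fixes a :: nat
  assumes "a div 2 ^ m = p" and "m \<le> k"
  shows "a div 2 ^ k = p div 2 ^ (k - m)"
proof -
  have "(2::nat) ^ k = 2 ^ m * 2 ^ (k - m)"
    using assms(2) by (simp flip: power_add)
  then show ?thesis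
    using assms(1) by (simp add: div_mult2_eq)
qed

text \<open>Condition \<open>k\<close> couples digit \<open>N - Suc k\<close> of \<open>a\<close>
  with digit \<open>k\<close> of \<open>b\<close>. For \<open>k \<ge> j\<close> all digits of
  \<open>b\<close> involved lie in the prefix \<open>q\<close>, so these conditions are rules for
  the free digits of \<open>a\<close>; for \<open>k < j\<close> they become rules for the free
  digits of \<open>b\<close>.\<close>

lemma ex1_nat_pair_with_digits:
  fixes F :: "nat \<Rightarrow> nat \<Rightarrow> nat \<Rightarrow> bool"
  assumes "j \<le> N"
  shows "\<exists>!(a, b). a div 2 ^ (N - j) = p \<and> b div 2 ^ j = q \<and>
    (\<forall>k<N. F k (a div 2 ^ (N - k)) (b div 2 ^ Suc k) \<longleftrightarrow>
       (odd (a div 2 ^ (N - Suc k)) \<longleftrightarrow> odd (b div 2 ^ k)))"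
    (is "\<exists>!(a, b). ?A a \<and> ?B b \<and> (\<forall>k<N. ?C k a b)")
proof -
  \<comment> \<open>Condition \<open>k = N - Suc i\<close> solved for digit \<open>i\<close> of
    \<open>a\<close>. The digits of \<open>b\<close> are read from \<open>q\<close>, so the rule
    does not mention \<open>b\<close>.\<close>
  define f where "f i u \<longleftrightarrow> (F (N - Suc i) u (q div 2 ^ (N - i - j)) \<longleftrightarrow> odd (q div 2 ^ (N - Suc i - j)))"
    for i u
  \<comment> \<open>Condition \<open>k\<close> solved for digit \<open>k\<close> of
    \<open>b\<close>, with \<open>a\<close> as a parameter; it becomes a fixed rule once
    \<open>a0\<close> has been found.\<close>
  define g where "g a k v \<longleftrightarrow> (F k (a div 2 ^ (N - k)) v \<longleftrightarrow> odd (a div 2 ^ (N - Suc k)))"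
    for a k v
  have high: "(\<forall>k\<in>{j..<N}. ?C k a b) \<longleftrightarrow> (\<forall>i<N - j. odd (a div 2 ^ i) \<longleftrightarrow> f i (a div 2 ^ Suc i))"
    (is "?L \<longleftrightarrow> ?R") if b: "?B b" for a b
  proof -
    \<comment> \<open>The substitution \<open>i = N - Suc k\<close> maps \<open>{j..<N}\<close> in
      reverse order onto the free positions \<open>i < N - j\<close> of \<open>a\<close>.\<close>
    have C: "?C k a b \<longleftrightarrow> (odd (a div 2 ^ (N - Suc k)) \<longleftrightarrow> f (N - Suc k) (a div 2 ^ Suc (N - Suc k)))"
      if k: "j \<le> k" "k < N" for k
    proof -
      have 1: "b div 2 ^ k = q div 2 ^ (k - j)" "b div 2 ^ Suc k = q div 2 ^ (Suc k - j)"
        using nat_div_power_of_prefix[OF b] k by (simp_all del: power_Suc)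
      have 2: "Suc (N - Suc k) = N - k" "N - (N - k) = k" "N - (N - Suc k) - j = Suc k - j"
        using k by auto
      show ?thesis
        unfolding f_def 1 2 by blast
    qed
    show ?thesis
    proof
      assume L: ?L
      show ?R
      proof (intro allI impI)
        fix i assume i: "i < N - j"
        then have k: "j \<le> N - Suc i" "N - Suc i < N" "N - Suc (N - Suc i) = i"
          by auto
        show "odd (a div 2 ^ i) \<longleftrightarrow> f i (a div 2 ^ Suc i)"
          using C[OF k(1,2)] bspec[OF L, of "N - Suc i"] k(1,2) unfolding k(3) by simp
      qed
    next
      assume R: ?R
      show ?L
      proof
        fix k assume k: "k \<in> {j..<N}"
        then have "N - Suc k < N - j" by auto
        then show "?C k a b"
          using C[of k] R k unfolding atLeastLessThan_iff by blast
      qed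
    qed
  qed
  have low: "(\<forall>k<j. ?C k a b) \<longleftrightarrow> (\<forall>k<j. odd (b div 2 ^ k) \<longleftrightarrow> g a k (b div 2 ^ Suc k))" for a b
    unfolding g_def by blast
  have split: "(\<forall>k<N. ?C k a b) \<longleftrightarrow> (\<forall>k\<in>{j..<N}. ?C k a b) \<and> (\<forall>k<j. ?C k a b)" for a b
    using assms by (meson atLeastLessThan_iff not_le order_less_le_trans)
  obtain a0 where a0: "?A a0" "\<forall>i<N - j. odd (a0 div 2 ^ i) \<longleftrightarrow> f i (a0 div 2 ^ Suc i)"
    and a0_unique: "\<And>a. ?A a \<Longrightarrow> \<forall>i<N - j. odd (a div 2 ^ i) \<longleftrightarrow> f i (a div 2 ^ Suc i) \<Longrightarrow> a = a0"
    using ex1_nat_with_digits[of "N - j" p f] by metis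
  obtain b0 where b0: "?B b0" "\<forall>k<j. odd (b0 div 2 ^ k) \<longleftrightarrow> g a0 k (b0 div 2 ^ Suc k)"
    and b0_unique: "\<And>b. ?B b \<Longrightarrow> \<forall>k<j. odd (b div 2 ^ k) \<longleftrightarrow> g a0 k (b div 2 ^ Suc k) \<Longrightarrow> b = b0"
    using ex1_nat_with_digits[of j q "g a0"] by metis
  show ?thesis
  proof (rule ex1I[of _ "(a0, b0)"])
    show "case (a0, b0) of (a, b) \<Rightarrow> ?A a \<and> ?B b \<and> (\<forall>k<N. ?C k a b)"
      unfolding prod.case split low high[OF b0(1)] using a0 b0 by blast
  next
    fix ab :: "nat \<times> nat"
    assume "case ab of (a, b) \<Rightarrow> ?A a \<and> ?B b \<and> (\<forall>k<N. ?C k a b)"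
    then obtain a b where ab: "ab = (a, b)" "?A a" "?B b" "\<forall>k<N. ?C k a b"
      by (cases ab) simp
    have "a = a0"
      using ab(4) a0_unique[OF ab(2)] unfolding split high[OF ab(3)] by blast
    moreover have "b = b0"
      using ab(4) b0_unique[OF ab(3)] unfolding split low \<open>a = a0\<close> by blast
    ultimately show "ab = (a0, b0)"
      using ab(1) by simp
  qed
qed

section \<open>Dyadic intervals and boxes in terms of indices\<close>

text \<open>For \<open>0 \<le> x < 1\<close> this is the number formed by the first \<open>k\<close>
  binary digits of \<open>x\<close>. Since \<open>nat\<close> sends negative floors to 0, negative
  \<open>x\<close> get index 0 as well, and the sign of \<open>x\<close> has to be tracked
  separately.\<close>

definition dyadic_index :: "nat \<Rightarrow> real \<Rightarrow> nat" where
  "dyadic_index k x = nat \<lfloor>x * 2 ^ k\<rfloor>"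

lemma mem_dyadic_interval_iff:
  "x \<in> dyadic_interval k m \<longleftrightarrow> 0 \<le> x \<and> dyadic_index k x = m"
proof -
  have "x \<in> dyadic_interval k m \<longleftrightarrow> real m \<le> x * 2 ^ k \<and> x * 2 ^ k < real m + 1"
    by (simp add: dyadic_interval_def field_simps)
  also have "\<dots> \<longleftrightarrow> \<lfloor>x * 2 ^ k\<rfloor> = int m"
    by (simp add: floor_eq_iff)
  also have "\<dots> \<longleftrightarrow> 0 \<le> x \<and> dyadic_index k x = m"
  proof -
    have "0 \<le> x \<longleftrightarrow> 0 \<le> \<lfloor>x * 2 ^ k\<rfloor>"
      unfolding zero_le_floor by (metis mult_le_cancel_right_pos mult_zero_left zero_less_numeral zero_less_power)
    then show ?thesis
      unfolding dyadic_index_def by linarith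
  qed
  finally show ?thesis .
qed

text \<open>Floor is compatible with division by a positive integer, so passing to a coarser level
  drops the last \<open>N - k\<close> binary digits.\<close>

lemma dyadic_index_coarser:
  assumes "k \<le> N"
  shows "dyadic_index k x = dyadic_index N x div 2 ^ (N - k)"
proof -
  have "x * 2 ^ k = x * 2 ^ N / of_int (2 ^ (N - k))"
    using assms by (simp add: field_simps flip: power_add)
  then have "\<lfloor>x * 2 ^ k\<rfloor> = \<lfloor>x * 2 ^ N\<rfloor> div 2 ^ (N - k)"
    by (simp only: floor_divide_real_eq_div zero_le_power zero_le_numeral)
  then show ?thesis
    unfolding dyadic_index_def
    by (simp only: nat_div_distrib' zero_le_power zero_le_numeral nat_power_eq nat_numeral)
qed

lemma dyadic_index_less:
  assumes "x < 1"
  shows "dyadic_index k x < 2 ^ k"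
  using assms by (simp add: dyadic_index_def nat_less_iff floor_less_iff)

lemma dyadic_index_of_grid [simp]: "dyadic_index k (real m / 2 ^ k) = m"
  by (simp add: dyadic_index_def)

lemma grid_mem_dyadic_interval: "real m / 2 ^ k \<in> dyadic_interval k m"
  by (simp add: mem_dyadic_interval_iff)

lemma dyadic_interval_nonempty: "dyadic_interval k m \<noteq> {}"
  using grid_mem_dyadic_interval by blast

lemma Inf_dyadic_interval: "Inf (dyadic_interval k m) = real m / 2 ^ k"
  unfolding dyadic_interval_def by (rule cInf_atLeastLessThan) (simp add: divide_strict_right_mono)

lemma Sup_dyadic_interval: "Sup (dyadic_interval k m) = (real m + 1) / 2 ^ k"
  unfolding dyadic_interval_def by (rule cSup_atLeastLessThan) (simp add: divide_strict_right_mono)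

lemma measure_dyadic_interval: "measure lborel (dyadic_interval k m) = 1 / 2 ^ k"
  by (simp add: dyadic_interval_def divide_right_mono add_divide_distrib)

text \<open>The length recovers \<open>k\<close>; then the left endpoint, whose index is
  \<open>m\<close>, recovers \<open>m\<close>. Summation over boxes as sets can therefore be
  replaced by summation over parameters.\<close>

lemma dyadic_interval_eq_iff:
  "dyadic_interval k m = dyadic_interval k' m' \<longleftrightarrow> k = k' \<and> m = m'"
proof
  assume eq: "dyadic_interval k m = dyadic_interval k' m'"
  then have "(1::real) / 2 ^ k = 1 / 2 ^ k'"
    by (metis measure_dyadic_interval)
  then have "k = k'" by simp
  with eq show "k = k' \<and> m = m'"
    by (metis grid_mem_dyadic_interval mem_dyadic_interval_iff)
qed simp

lemma dyadic_interval_times_eq_iff: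
  "dyadic_interval k p \<times> dyadic_interval l q = dyadic_interval k' p' \<times> dyadic_interval l' q' \<longleftrightarrow>
    k = k' \<and> p = p' \<and> l = l' \<and> q = q'"
  by (auto simp: times_eq_iff dyadic_interval_nonempty dyadic_interval_eq_iff)

lemma measure_dyadic_box:
  "measure lborel (dyadic_interval k p \<times> dyadic_interval l q) = 1 / 2 ^ (k + l)"
proof -
  have "measure (lborel \<Otimes>\<^sub>M lborel) (dyadic_interval k p \<times> dyadic_interval l q) =
      measure lborel (dyadic_interval k p) * measure lborel (dyadic_interval l q)"
    unfolding measure_def
    by (subst lborel.emeasure_pair_measure_Times)
      (simp_all add: dyadic_interval_def enn2real_mult)
  then show ?thesis
    unfolding lborel_prod measure_dyadic_interval by (simp add: power_add)
qed

text \<open>The area \<open>1 / 2 ^ (k + l)\<close> forces \<open>k + l = n\<close>, so the shape of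
  a box is determined by \<open>k\<close> alone.\<close>

lemma dyadic_boxes_of_area_eq:
  "dyadic_boxes_of_area (1 / 2 ^ n) =
    {dyadic_interval k p \<times> dyadic_interval (n - k) q | k p q. k \<le> n \<and> p < 2 ^ k \<and> q < 2 ^ (n - k)}"
  (is "?L = ?R")
proof (intro Set.set_eqI iffI)
  fix R assume "R \<in> ?L"
  then obtain k p l q where *: "R = dyadic_interval k p \<times> dyadic_interval l q" "p < 2 ^ k" "q < 2 ^ l"
    and "measure lborel R = 1 / 2 ^ n"
    unfolding dyadic_boxes_of_area_def dyadic_boxes_def dyadic_intervals_def by blast
  then have "(2::real) ^ (k + l) = 2 ^ n"
    by (simp add: measure_dyadic_box del: power_inject_exp)
  then have "k + l = n" by simp
  then have "k \<le> n" "l = n - k" by auto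
  with * show "R \<in> ?R" by blast
next
  fix R assume "R \<in> ?R"
  then show "R \<in> ?L"
    unfolding dyadic_boxes_of_area_def dyadic_boxes_def dyadic_intervals_def
    using measure_dyadic_box by fastforce
qed

lemma finite_dyadic_boxes_of_area: "finite (dyadic_boxes_of_area (1 / 2 ^ n))"
proof (rule finite_subset)
  show "dyadic_boxes_of_area (1 / 2 ^ n) \<subseteq>
    (\<lambda>(k, p, q). dyadic_interval k p \<times> dyadic_interval (n - k) q) `
      (SIGMA k:{..n}. {..<2 ^ k} \<times> {..<2 ^ (n - k)})"
    unfolding dyadic_boxes_of_area_eq by force
qed auto

section \<open>Evaluation of the signed Haar sum\<close>

text \<open>The Haar value read off from the next binary digit: 0 is the left half, with value -1,
  and 1 is the right half, with value 1.\<close>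

definition parity_sign :: "nat \<Rightarrow> real" where
  "parity_sign m = (if odd m then 1 else - 1)"

text \<open>The halves of interval \<open>m\<close> at level \<open>k\<close> are the intervals
  \<open>2 * m\<close> and \<open>2 * m + 1\<close> at level \<open>Suc k\<close>, so the parity of
  the finer index tells on which side \<open>x\<close> lies.\<close>

lemma haar_dyadic_interval:
  assumes "0 \<le> x"
  shows "haar (dyadic_interval k m) x =
    (if dyadic_index k x = m then parity_sign (dyadic_index (Suc k) x) else 0)"
proof -
  have ends: "real m / 2 ^ k = real (2 * m) / 2 ^ Suc k"
    "(real m + 1) / 2 ^ k = (real (2 * m + 1) + 1) / 2 ^ Suc k"
    "(real m / 2 ^ k + (real m + 1) / 2 ^ k) / 2 = (real (2 * m) + 1) / 2 ^ Suc k"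
    by (simp_all add: field_simps)
  have "left_half (dyadic_interval k m) = dyadic_interval (Suc k) (2 * m)"
    "right_half (dyadic_interval k m) = dyadic_interval (Suc k) (2 * m + 1)"
    unfolding left_half_def right_half_def Inf_dyadic_interval Sup_dyadic_interval ends(3)
    unfolding dyadic_interval_def ends(1,2) by (simp_all add: add.commute)
  moreover have "dyadic_index k x = dyadic_index (Suc k) x div 2"
    using dyadic_index_coarser[of k "Suc k" x] by simp
  ultimately show ?thesis
    using assms unfolding haar_def parity_sign_def
    by (auto simp: indicator_def mem_dyadic_interval_iff elim!: oddE evenE)
qed

text \<open>The contribution of the box of width \<open>1 / 2 ^ k\<close> around a point whose
  coordinates have level \<open>Suc n\<close> indices \<open>a\<close> and \<open>b\<close>. Level
  \<open>Suc n\<close> is fine enough because a Haar function at level at most \<open>n\<close>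
  looks one digit further.\<close>

definition haar_term ::
  "nat \<Rightarrow> ((real \<times> real) set \<Rightarrow> real) \<Rightarrow> nat \<Rightarrow> nat \<Rightarrow> nat \<Rightarrow> real" where
  "haar_term n \<epsilon> a b k =
    \<epsilon> (dyadic_interval k (a div 2 ^ (Suc n - k)) \<times> dyadic_interval (n - k) (b div 2 ^ Suc k)) *
    (parity_sign (a div 2 ^ (n - k)) * parity_sign (b div 2 ^ k))"

text \<open>For each \<open>k \<le> n\<close> only the box around \<open>x\<close> contributes, the
  Haar functions of the others being 0 at \<open>x\<close>.\<close>

lemma signed_haar_sum_eq:
  assumes "x \<in> unit_square"
  shows "signed_haar_sum n \<epsilon> x =
    (\<Sum>k\<le>n. haar_term n \<epsilon> (dyadic_index (Suc n) (fst x)) (dyadic_index (Suc n) (snd x)) k)"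
proof -
  obtain u v where x: "x = (u, v)" and uv: "0 \<le> u" "u < 1" "0 \<le> v" "v < 1"
    using assms by (auto simp: unit_square_def)
  define box where "box k = dyadic_interval k (dyadic_index k u) \<times> dyadic_interval (n - k) (dyadic_index (n - k) v)"
    for k
  have box_value: "haar_box (dyadic_interval k p \<times> dyadic_interval l q) x =
      (if dyadic_index k u = p \<and> dyadic_index l v = q
       then parity_sign (dyadic_index (Suc k) u) * parity_sign (dyadic_index (Suc l) v) else 0)"
    for k p l q
    using uv by (simp add: haar_box_def x dyadic_interval_nonempty haar_dyadic_interval)
  have "signed_haar_sum n \<epsilon> x = (\<Sum>R\<in>box ` {..n}. \<epsilon> R * haar_box R x)"
    unfolding signed_haar_sum_def
  proof (rule sum.mono_neutral_right)
    show "finite (dyadic_boxes_of_area (1 / 2 ^ n))"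
      by (rule finite_dyadic_boxes_of_area)
    show "box ` {..n} \<subseteq> dyadic_boxes_of_area (1 / 2 ^ n)"
      unfolding dyadic_boxes_of_area_eq box_def using uv dyadic_index_less by blast
    show "\<forall>R\<in>dyadic_boxes_of_area (1 / 2 ^ n) - box ` {..n}. \<epsilon> R * haar_box R x = 0"
    proof
      fix R assume "R \<in> dyadic_boxes_of_area (1 / 2 ^ n) - box ` {..n}"
      then obtain k p q where R: "R = dyadic_interval k p \<times> dyadic_interval (n - k) q"
        and "k \<le> n" "R \<notin> box ` {..n}"
        unfolding dyadic_boxes_of_area_eq by blast
      then have "\<not> (dyadic_index k u = p \<and> dyadic_index (n - k) v = q)"
        unfolding box_def by blast
      then show "\<epsilon> R * haar_box R x = 0"
        unfolding R box_value by (simp only: if_False mult_zero_right)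
    qed
  qed
  \<comment> \<open>The boxes around \<open>x\<close> are pairwise different, as \<open>k\<close>
    can be recovered from the first side.\<close>
  also have "\<dots> = (\<Sum>k\<le>n. \<epsilon> (box k) * haar_box (box k) x)"
    by (subst sum.reindex) (auto simp: inj_on_def box_def dyadic_interval_times_eq_iff)
  also have "\<dots> = (\<Sum>k\<le>n. haar_term n \<epsilon> (dyadic_index (Suc n) u) (dyadic_index (Suc n) v) k)"
  proof (rule sum.cong[OF refl])
    fix k assume "k \<in> {..n}"
    then have k: "k \<le> n" by simp
    have "dyadic_index k u = dyadic_index (Suc n) u div 2 ^ (Suc n - k)"
      "dyadic_index (Suc k) u = dyadic_index (Suc n) u div 2 ^ (n - k)"
      "dyadic_index (n - k) v = dyadic_index (Suc n) v div 2 ^ Suc k"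
      "dyadic_index (Suc (n - k)) v = dyadic_index (Suc n) v div 2 ^ k"
      using k dyadic_index_coarser[of k "Suc n" u] dyadic_index_coarser[of "Suc k" "Suc n" u]
        dyadic_index_coarser[of "n - k" "Suc n" v] dyadic_index_coarser[of "Suc (n - k)" "Suc n" v]
      by (simp_all add: Suc_diff_le)
    then show "\<epsilon> (box k) * haar_box (box k) x =
        haar_term n \<epsilon> (dyadic_index (Suc n) u) (dyadic_index (Suc n) v) k"
      unfolding box_def haar_term_def box_value by simp
  qed
  finally show ?thesis by (simp add: x)
qed

section \<open>Maximality as a condition on digits\<close>

text \<open>The deficits \<open>1 - f x\<close> are nonnegative, so their sum vanishes only if each
  of them does.\<close>

lemma sum_eq_card_iff:
  fixes f :: "'a \<Rightarrow> real"
  assumes "finite A" and "\<And>x. x \<in> A \<Longrightarrow> f x \<le> 1"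
  shows "sum f A = real (card A) \<longleftrightarrow> (\<forall>x\<in>A. f x = 1)"
proof -
  have "sum f A = real (card A) \<longleftrightarrow> (\<Sum>x\<in>A. 1 - f x) = 0"
    by (simp add: sum_subtractf) linarith
  also have "\<dots> \<longleftrightarrow> (\<forall>x\<in>A. f x = 1)"
    using assms by (subst sum_nonneg_eq_0_iff) auto
  finally show ?thesis .
qed

text \<open>The two parity signs multiply to 1 exactly if the digits agree. The bounds on
  \<open>a\<close> and \<open>b\<close> make the box one for which \<open>\<epsilon>\<close> is
  known to be a sign. The unsimplified \<open>Suc n - Suc k\<close> matches
  \<open>ex1_nat_pair_with_digits\<close> with \<open>N = Suc n\<close>.\<close>

lemma haar_term_cases:
  assumes signs: "\<forall>R\<in>dyadic_boxes_of_area (1 / 2 ^ n). \<epsilon> R \<in> {-1, 1}"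
    and "a < 2 ^ Suc n" "b < 2 ^ Suc n" "k \<le> n"
  shows "haar_term n \<epsilon> a b k \<in> {-1, 1}"
    and "haar_term n \<epsilon> a b k = 1 \<longleftrightarrow>
      (\<epsilon> (dyadic_interval k (a div 2 ^ (Suc n - k)) \<times> dyadic_interval (n - k) (b div 2 ^ Suc k)) = 1 \<longleftrightarrow>
        (odd (a div 2 ^ (Suc n - Suc k)) \<longleftrightarrow> odd (b div 2 ^ k)))"
proof -
  have "a div 2 ^ (Suc n - k) < 2 ^ k"
    using assms by (intro less_mult_imp_div_less) (simp flip: power_add)
  moreover have "b div 2 ^ Suc k < 2 ^ (n - k)"
    using assms by (intro less_mult_imp_div_less) (simp flip: power_add power_Suc)
  ultimately have "dyadic_interval k (a div 2 ^ (Suc n - k)) \<times> dyadic_interval (n - k) (b div 2 ^ Suc k)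
      \<in> dyadic_boxes_of_area (1 / 2 ^ n)"
    unfolding dyadic_boxes_of_area_eq using assms(4) by blast
  from bspec[OF signs this] show "haar_term n \<epsilon> a b k \<in> {-1, 1}" "haar_term n \<epsilon> a b k = 1 \<longleftrightarrow>
      (\<epsilon> (dyadic_interval k (a div 2 ^ (Suc n - k)) \<times> dyadic_interval (n - k) (b div 2 ^ Suc k)) = 1 \<longleftrightarrow>
        (odd (a div 2 ^ (Suc n - Suc k)) \<longleftrightarrow> odd (b div 2 ^ k)))"
    unfolding haar_term_def parity_sign_def by auto
qed

section \<open>Grid squares of maximal value and their distribution\<close>

definition maximal_cells :: "nat \<Rightarrow> ((real \<times> real) set \<Rightarrow> real) \<Rightarrow> (nat \<times> nat) set" where
  "maximal_cells n \<epsilon> =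
    {(a, b). a < 2 ^ Suc n \<and> b < 2 ^ Suc n \<and> (\<forall>k\<le>n. haar_term n \<epsilon> a b k = 1)}"

definition grid_square :: "nat \<Rightarrow> nat \<times> nat \<Rightarrow> (real \<times> real) set" where
  "grid_square N ab = dyadic_interval N (fst ab) \<times> dyadic_interval N (snd ab)"

lemma inj_grid_square: "inj (grid_square N)"
  by (auto simp: inj_def grid_square_def dyadic_interval_times_eq_iff prod_eq_iff)

lemma lower_left_corner_grid_square:
  "lower_left_corner (grid_square N (a, b)) = (real a / 2 ^ N, real b / 2 ^ N)"
  by (simp add: lower_left_corner_def grid_square_def dyadic_interval_nonempty Inf_dyadic_interval)

lemma grid_corner_mem_box_iff:
  assumes "j \<le> N"
  shows "(real a / 2 ^ N, real b / 2 ^ N) \<in> dyadic_interval j p \<times> dyadic_interval (N - j) q \<longleftrightarrow>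
    a div 2 ^ (N - j) = p \<and> b div 2 ^ j = q"
  using dyadic_index_coarser[of j N "real a / 2 ^ N"] dyadic_index_coarser[of "N - j" N "real b / 2 ^ N"] assms
  by (auto simp add: mem_dyadic_interval_iff)

text \<open>A box of this shape does not cut through a cell of the level \<open>N\<close> grid, so
  the corner decides about the whole square. Inclusion of squares and membership of corners thus
  reduce to the same digit condition.\<close>

lemma grid_square_subset_box_iff:
  assumes "j \<le> N"
  shows "grid_square N (a, b) \<subseteq> dyadic_interval j p \<times> dyadic_interval (N - j) q \<longleftrightarrow>
    a div 2 ^ (N - j) = p \<and> b div 2 ^ j = q"
proof
  assume "grid_square N (a, b) \<subseteq> dyadic_interval j p \<times> dyadic_interval (N - j) q"
  then have "(real a / 2 ^ N, real b / 2 ^ N) \<in> dyadic_interval j p \<times> dyadic_interval (N - j) q"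
    using grid_mem_dyadic_interval unfolding grid_square_def by fastforce
  then show "a div 2 ^ (N - j) = p \<and> b div 2 ^ j = q"
    using grid_corner_mem_box_iff[OF assms] by blast
next
  assume "a div 2 ^ (N - j) = p \<and> b div 2 ^ j = q"
  then show "grid_square N (a, b) \<subseteq> dyadic_interval j p \<times> dyadic_interval (N - j) q"
    using dyadic_index_coarser[of j N] dyadic_index_coarser[of "N - j" N] assms
    by (auto simp: grid_square_def mem_dyadic_interval_iff)
qed

text \<open>The prefixes \<open>p\<close> and \<open>q\<close> bound \<open>a\<close> and
  \<open>b\<close> by \<open>2 ^ Suc n\<close>; what remains are the conditions of
  \<open>ex1_nat_pair_with_digits\<close>, with \<open>F k u v\<close> saying that the box with
  indices \<open>u\<close> and \<open>v\<close> has sign 1.\<close>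

lemma ex1_maximal_cell:
  assumes signs: "\<forall>R\<in>dyadic_boxes_of_area (1 / 2 ^ n). \<epsilon> R \<in> {-1, 1}"
    and j: "j \<le> Suc n" and p: "p < 2 ^ j" and q: "q < 2 ^ (Suc n - j)"
  shows "\<exists>!(a, b). (a, b) \<in> maximal_cells n \<epsilon> \<and> a div 2 ^ (Suc n - j) = p \<and> b div 2 ^ j = q"
proof -
  have "(a, b) \<in> maximal_cells n \<epsilon> \<and> a div 2 ^ (Suc n - j) = p \<and> b div 2 ^ j = q \<longleftrightarrow>
      a div 2 ^ (Suc n - j) = p \<and> b div 2 ^ j = q \<and>
      (\<forall>k<Suc n. \<epsilon> (dyadic_interval k (a div 2 ^ (Suc n - k)) \<times> dyadic_interval (n - k) (b div 2 ^ Suc k)) = 1 \<longleftrightarrow>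
        (odd (a div 2 ^ (Suc n - Suc k)) \<longleftrightarrow> odd (b div 2 ^ k)))"
    (is "_ \<longleftrightarrow> ?A \<and> ?B \<and> ?C") for a b
  proof (cases "?A \<and> ?B")
    case True
    then have "a < 2 ^ j * 2 ^ (Suc n - j)" "b < 2 ^ (Suc n - j) * 2 ^ j"
      using p q by (simp_all flip: div_less_iff_less_mult)
    then have ab: "a < 2 ^ Suc n" "b < 2 ^ Suc n"
      using j by (simp_all flip: power_add power_Suc)
    have "(\<forall>k\<le>n. haar_term n \<epsilon> a b k = 1) \<longleftrightarrow> ?C"
      using haar_term_cases(2)[OF signs ab] by (simp only: less_Suc_eq_le cong: conj_cong) blast
    with True ab show ?thesis
      unfolding maximal_cells_def by blast
  qed blast
  then show ?thesis
    using ex1_nat_pair_with_digits[OF j, of p q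
        "\<lambda>k u v. \<epsilon> (dyadic_interval k u \<times> dyadic_interval (n - k) v) = 1"]
    by simp
qed

text \<open>Boxes with \<open>j = Suc n\<close> are vertical strips of full height: the prefix of
  \<open>a\<close> is all of \<open>a\<close>, and that of \<open>b\<close> is empty, hence
  \<open>q = 0\<close>. Each of the \<open>2 ^ Suc n\<close> strips contains one cell, so
  \<open>fst\<close> is a bijection onto the strips.\<close>

lemma card_maximal_cells:
  assumes "\<forall>R\<in>dyadic_boxes_of_area (1 / 2 ^ n). \<epsilon> R \<in> {-1, 1}"
  shows "finite (maximal_cells n \<epsilon>)" and "card (maximal_cells n \<epsilon>) = 2 ^ Suc n"
proof -
  have ex1: "\<exists>!(a', b). (a', b) \<in> maximal_cells n \<epsilon> \<and> a' = a" if "a < 2 ^ Suc n" for a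
  proof -
    have "(a', b) \<in> maximal_cells n \<epsilon> \<and> a' div 2 ^ (Suc n - Suc n) = a \<and> b div 2 ^ Suc n = 0 \<longleftrightarrow>
        (a', b) \<in> maximal_cells n \<epsilon> \<and> a' = a" for a' b
      by (auto simp: maximal_cells_def simp del: power_Suc)
    then show ?thesis
      using ex1_maximal_cell[OF assms, of "Suc n" a 0] that by simp
  qed
  have "bij_betw fst (maximal_cells n \<epsilon>) {..<2 ^ Suc n}"
  proof (rule bij_betw_imageI)
    have less: "fst c < 2 ^ Suc n" if "c \<in> maximal_cells n \<epsilon>" for c
      using that by (auto simp: maximal_cells_def)
    show "inj_on fst (maximal_cells n \<epsilon>)"
    proof (rule inj_onI)
      fix c d assume "c \<in> maximal_cells n \<epsilon>" "d \<in> maximal_cells n \<epsilon>" "fst c = fst d"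
      then show "c = d"
        using ex1[OF less[of c]] by (auto simp: case_prod_unfold)
    qed
    show "fst ` maximal_cells n \<epsilon> = {..<2 ^ Suc n}"
    proof
      show "{..<2 ^ Suc n} \<subseteq> fst ` maximal_cells n \<epsilon>"
        using ex1 by (force simp: case_prod_unfold)
    qed (use less in blast)
  qed
  then show "finite (maximal_cells n \<epsilon>)" "card (maximal_cells n \<epsilon>) = 2 ^ Suc n"
    using bij_betw_finite bij_betw_same_card by fastforce+
qed

theorem theorem7:
  fixes n :: nat and \<epsilon> :: "(real \<times> real) set \<Rightarrow> real"
  assumes "\<And>R. R \<in> dyadic_boxes_of_area (1 / 2 ^ n) \<Longrightarrow> \<epsilon> R \<in> {-1, 1}"
  shows "(\<forall>x \<in> unit_square. signed_haar_sum n \<epsilon> x \<le> real n + 1) \<and>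
    (\<exists>x \<in> unit_square. signed_haar_sum n \<epsilon> x = real n + 1) \<and>
    (\<exists>Q. Q \<subseteq> dyadic_squares_of_side (1 / 2 ^ (n + 1)) \<and>
       finite Q \<and> card Q = 2 ^ (n + 1) \<and>
       {x \<in> unit_square. signed_haar_sum n \<epsilon> x = real n + 1} = \<Union>Q \<and>
       binary_net 0 (n + 1) (lower_left_corner ` Q) \<and>
       (\<forall>R \<in> dyadic_boxes_of_area (1 / 2 ^ (n + 1)). \<exists>!S. S \<in> Q \<and> S \<subseteq> R))"
proof -
  have signs: "\<forall>R\<in>dyadic_boxes_of_area (1 / 2 ^ n). \<epsilon> R \<in> {-1, 1}"
    using assms by blast
  define M where "M = maximal_cells n \<epsilon>"
  define Q where "Q = grid_square (Suc n) ` M"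
  have M_less: "a < 2 ^ Suc n" "b < 2 ^ Suc n" if "(a, b) \<in> M" for a b
    using that by (auto simp: M_def maximal_cells_def)
  have finM: "finite M" and cardM: "card M = 2 ^ Suc n"
    using card_maximal_cells[OF signs] by (simp_all add: M_def)
  have term_le: "haar_term n \<epsilon> (dyadic_index (Suc n) (fst x)) (dyadic_index (Suc n) (snd x)) k \<le> 1"
    if "x \<in> unit_square" "k \<in> {..n}" for x k
  proof -
    have "dyadic_index (Suc n) (fst x) < 2 ^ Suc n" "dyadic_index (Suc n) (snd x) < 2 ^ Suc n"
      using that(1) by (auto simp: unit_square_def dyadic_index_less simp del: power_Suc)
    from haar_term_cases(1)[OF signs this, of k] that(2) show ?thesis by auto
  qed
  have upper: "signed_haar_sum n \<epsilon> x \<le> real n + 1" if "x \<in> unit_square" for x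
    using sum_bounded_above[of "{..n}", OF term_le[OF that]] unfolding signed_haar_sum_eq[OF that]
    by (simp add: add.commute)
  have maximal: "signed_haar_sum n \<epsilon> x = real n + 1 \<longleftrightarrow>
      (dyadic_index (Suc n) (fst x), dyadic_index (Suc n) (snd x)) \<in> M" if "x \<in> unit_square" for x
  proof -
    have "signed_haar_sum n \<epsilon> x = real n + 1 \<longleftrightarrow>
      (\<forall>k\<in>{..n}. haar_term n \<epsilon> (dyadic_index (Suc n) (fst x)) (dyadic_index (Suc n) (snd x)) k = 1)"
      using sum_eq_card_iff[OF finite_atMost term_le[OF that]] unfolding signed_haar_sum_eq[OF that]
      by (simp add: add.commute)
    moreover have "dyadic_index (Suc n) (fst x) < 2 ^ Suc n" "dyadic_index (Suc n) (snd x) < 2 ^ Suc n"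
      using that by (auto simp: unit_square_def dyadic_index_less simp del: power_Suc)
    ultimately show ?thesis
      by (auto simp: M_def maximal_cells_def)
  qed
  have in_unit: "0 \<le> x \<and> x < 1" if "x \<in> dyadic_interval (Suc n) m" "m < 2 ^ Suc n" for x m
  proof -
    \<comment> \<open>The only interval of level 0 with index 0 is \<open>[0, 1)\<close>; dropping
      all \<open>Suc n\<close> digits of \<open>m\<close> leaves 0.\<close>
    have "dyadic_index 0 x = 0"
      using that dyadic_index_coarser[of 0 "Suc n" x] by (simp add: mem_dyadic_interval_iff)
    moreover have "0 \<le> x"
      using that by (simp add: mem_dyadic_interval_iff)
    ultimately show ?thesis
      using mem_dyadic_interval_iff[of x 0 0] by (simp add: dyadic_interval_def)
  qed
  have union: "{x \<in> unit_square. signed_haar_sum n \<epsilon> x = real n + 1} = \<Union>Q" (is "?L = _")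
  proof (intro Set.set_eqI iffI)
    fix x assume "x \<in> ?L"
    then have "(dyadic_index (Suc n) (fst x), dyadic_index (Suc n) (snd x)) \<in> M" "0 \<le> fst x" "0 \<le> snd x"
      using maximal by (auto simp: unit_square_def)
    then show "x \<in> \<Union>Q"
      by (force simp: Q_def grid_square_def mem_Times_iff mem_dyadic_interval_iff)
  next
    fix x assume "x \<in> \<Union>Q"
    then obtain a b where ab: "(a, b) \<in> M" "fst x \<in> dyadic_interval (Suc n) a" "snd x \<in> dyadic_interval (Suc n) b"
      by (auto simp: Q_def grid_square_def mem_Times_iff)
    then have "x \<in> unit_square"
      using in_unit M_less by (simp add: unit_square_def mem_Times_iff)
    with ab show "x \<in> ?L"
      using maximal by (simp add: mem_dyadic_interval_iff)
  qed
  have squares: "Q \<subseteq> dyadic_squares_of_side (1 / 2 ^ (n + 1))"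
  proof
    fix S assume "S \<in> Q"
    then obtain a b where ab: "(a, b) \<in> M" and S: "S = dyadic_interval (Suc n) a \<times> dyadic_interval (Suc n) b"
      by (auto simp: Q_def grid_square_def)
    have "dyadic_interval (Suc n) a \<in> dyadic_intervals" "dyadic_interval (Suc n) b \<in> dyadic_intervals"
      using M_less[OF ab] unfolding dyadic_intervals_def by blast+
    then show "S \<in> dyadic_squares_of_side (1 / 2 ^ (n + 1))"
      unfolding dyadic_squares_of_side_def dyadic_squares_def S
      by (auto simp: measure_dyadic_interval dyadic_interval_nonempty
          simp del: power_Suc times_eq_iff intro!: exI)
  qed
  have finQ: "finite Q" and cardQ: "card Q = 2 ^ (n + 1)"
    using finM cardM card_image[OF inj_on_subset[OF inj_grid_square subset_UNIV]] by (auto simp: Q_def)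
  have one_cell: "\<exists>!c. c \<in> M \<and> grid_square (Suc n) c \<subseteq> R"
    "\<exists>!c. c \<in> M \<and> lower_left_corner (grid_square (Suc n) c) \<in> R"
    if R: "R \<in> dyadic_boxes_of_area (1 / 2 ^ (n + 1))" for R
  proof -
    obtain j p q where j: "j \<le> Suc n" and pq: "p < 2 ^ j" "q < 2 ^ (Suc n - j)"
      and R: "R = dyadic_interval j p \<times> dyadic_interval (Suc n - j) q"
      using R unfolding Suc_eq_plus1[symmetric] dyadic_boxes_of_area_eq by blast
    \<comment> \<open>This one digit statement yields both claims, for inclusion of squares and for
      membership of corners.\<close>
    have cell: "\<exists>!c. c \<in> M \<and> fst c div 2 ^ (Suc n - j) = p \<and> snd c div 2 ^ j = q"
      using ex1_maximal_cell[OF signs j pq] unfolding case_prod_unfold prod.collapse M_def .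
    have "grid_square (Suc n) c \<subseteq> R \<longleftrightarrow> fst c div 2 ^ (Suc n - j) = p \<and> snd c div 2 ^ j = q"
      "lower_left_corner (grid_square (Suc n) c) \<in> R \<longleftrightarrow> fst c div 2 ^ (Suc n - j) = p \<and> snd c div 2 ^ j = q"
      for c
      unfolding R using grid_square_subset_box_iff[OF j] grid_corner_mem_box_iff[OF j]
      by (cases c; simp only: lower_left_corner_grid_square fst_conv snd_conv)+
    with cell show "\<exists>!c. c \<in> M \<and> grid_square (Suc n) c \<subseteq> R"
      "\<exists>!c. c \<in> M \<and> lower_left_corner (grid_square (Suc n) c) \<in> R"
      by simp_all
  qed
  have unique: "\<exists>!S. S \<in> Q \<and> S \<subseteq> R" if "R \<in> dyadic_boxes_of_area (1 / 2 ^ (n + 1))" for R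
    using one_cell(1)[OF that] unfolding Q_def by blast
  have inj_corner: "inj_on lower_left_corner Q"
    by (auto simp: inj_on_def Q_def lower_left_corner_grid_square)
  have net: "binary_net 0 (n + 1) (lower_left_corner ` Q)"
    unfolding binary_net_def
  proof (intro conjI ballI)
    show "lower_left_corner ` Q \<subseteq> unit_square"
      using M_less by (auto simp: Q_def lower_left_corner_grid_square unit_square_def
          simp del: power_Suc)
    show "finite (lower_left_corner ` Q)" "card (lower_left_corner ` Q) = 2 ^ (n + 1)"
      using finQ cardQ inj_corner by (simp_all add: card_image)
    fix R assume "R \<in> dyadic_boxes_of_area (2 powi (int 0 - int (n + 1)))"
    \<comment> \<open>With \<open>t = 0\<close> the boxes tested by the net property are those of
      area \<open>1 / 2 ^ (n + 1)\<close>, to which \<open>one_cell\<close> applies.\<close>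
    moreover have "(2::real) powi (int 0 - int (n + 1)) = 1 / 2 ^ (n + 1)"
      by (simp only: of_nat_0 diff_0 power_int_minus power_int_of_nat inverse_eq_divide)
    ultimately obtain c where c: "c \<in> M" "lower_left_corner (grid_square (Suc n) c) \<in> R"
      "\<And>d. d \<in> M \<Longrightarrow> lower_left_corner (grid_square (Suc n) d) \<in> R \<Longrightarrow> d = c"
      using one_cell(2)[of R] by metis
    then have "lower_left_corner ` Q \<inter> R = {lower_left_corner (grid_square (Suc n) c)}"
      unfolding Q_def by blast
    then show "card (lower_left_corner ` Q \<inter> R) = 2 ^ 0" by simp
  qed
  \<comment> \<open>The count of cells shows that the bound \<open>n + 1\<close> is attained: every
    point of a square in \<open>Q\<close> is a maximum point.\<close>
  have "M \<noteq> {}"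
    using cardM by auto
  then have "\<Union>Q \<noteq> {}"
    by (auto simp: Q_def grid_square_def dyadic_interval_nonempty)
  then have attained: "\<exists>x\<in>unit_square. signed_haar_sum n \<epsilon> x = real n + 1"
    unfolding union[symmetric] by blast
  show ?thesis
    by (intro conjI exI[of _ Q] ballI upper attained squares finQ cardQ union net unique)
qed

end
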